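(* If $n\ge 3$ is odd, then $p(C_n)=\widehat{p}(C_n)=\lceil \lg n\rceil+1$.
   Context: $C_n$ is the cycle with $n$ vertices; $\lg$ is the logarithm to base 2. An edge-coloring of a graph $G$ is any assignment of colors to its edges. A walk is closed if its two endpoints coincide, and open otherwise. A parity walk (in an edge-coloring) is a walk along which every color is used an even number of times (counting repeated traversals). A parity path is a parity walk that is a path with at least one edge. A parity edge-coloring is an edge-coloring having no parity path, and $p(G)$ is the minimum number of colors in a parity edge-coloring of $G$. A strong parity edge-coloring (spec) is an edge-coloring in which every parity walk is closed, and $\widehat{p}(G)$ is the minimum number of colors in a spec of $G$. *)

theory Defs
  imports Complex_Main "Graph_Theory.Graph_Theory"
begin

text \<open>A simple graph is a symmetric loopfree digraph without parallel arcs: the undirected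
  edge joining u and v is the pair of arcs (u,v) and (v,u).  Colors are assigned to unordered
  pairs, so that both directions of traversal carry the same color.\<close>

definition edges :: "'a pair_pre_digraph \<Rightarrow> 'a set set" where
  "edges G = {{u, v} | u v. (u, v) \<in> parcs G}"

text \<open>Edge-colorings are arbitrary functions on unordered pairs; values outside
  \<open>edges G\<close> are irrelevant, and only colors occurring on \<open>edges G\<close> are counted.  Natural
  numbers are enough colors, as the graphs considered are finite.\<close>

type_synonym 'a edge_coloring = "'a set \<Rightarrow> nat"

definition num_colors :: "'a pair_pre_digraph \<Rightarrow> 'a edge_coloring \<Rightarrow> nat" where
  "num_colors G c = card (c ` edges G)"

text \<open>Walks are given by their nonempty vertex lists; the single-vertex walk is allowed.\<close>

definition walk_colors :: "'a edge_coloring \<Rightarrow> 'a vwalk \<Rightarrow> nat list" where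
  "walk_colors c w = map (\<lambda>(u, v). c {u, v}) (vwalk_arcs w)"

definition parity_walk :: "'a pair_pre_digraph \<Rightarrow> 'a edge_coloring \<Rightarrow> 'a vwalk \<Rightarrow> bool" where
  "parity_walk G c w \<longleftrightarrow>
     vwalk w (with_proj G) \<and> (\<forall>a. even (count_list (walk_colors c w) a))"

definition parity_path :: "'a pair_pre_digraph \<Rightarrow> 'a edge_coloring \<Rightarrow> 'a vwalk \<Rightarrow> bool" where
  "parity_path G c w \<longleftrightarrow>
     parity_walk G c w \<and> vpath w (with_proj G) \<and> vwalk_length w \<ge> 1"

definition closed_vwalk :: "'a vwalk \<Rightarrow> bool" where
  "closed_vwalk w \<longleftrightarrow> hd w = last w"

definition parity_edge_coloring :: "'a pair_pre_digraph \<Rightarrow> 'a edge_coloring \<Rightarrow> bool" where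
  "parity_edge_coloring G c \<longleftrightarrow> (\<nexists>w. parity_path G c w)"

definition strong_parity_edge_coloring ::
    "'a pair_pre_digraph \<Rightarrow> 'a edge_coloring \<Rightarrow> bool" where
  "strong_parity_edge_coloring G c \<longleftrightarrow> (\<forall>w. parity_walk G c w \<longrightarrow> closed_vwalk w)"

definition parity_number :: "'a pair_pre_digraph \<Rightarrow> nat" where
  "parity_number G = (LEAST k. \<exists>c. parity_edge_coloring G c \<and> num_colors G c = k)"

definition strong_parity_number :: "'a pair_pre_digraph \<Rightarrow> nat" where
  "strong_parity_number G =
     (LEAST k. \<exists>c. strong_parity_edge_coloring G c \<and> num_colors G c = k)"

definition cycle_graph :: "nat \<Rightarrow> nat pair_pre_digraph" where
  "cycle_graph n =
     \<lparr> pverts = {..<n},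
       parcs = {(i, j). i < n \<and> j < n \<and> (j = (i + 1) mod n \<or> i = (j + 1) mod n)} \<rparr>"

lemma pair_graph_cycle_graph:
  assumes "n \<ge> 3"
  shows "pair_graph (cycle_graph n)"
proof
  have "parcs (cycle_graph n) \<subseteq> {..<n} \<times> {..<n}"
    by (auto simp: cycle_graph_def)
  then show "finite (parcs (cycle_graph n))"
    by (rule finite_subset) simp
  show "symmetric (with_proj (cycle_graph n))"
    by (auto simp: symmetric_def cycle_graph_def sym_def)
  show "fst e \<noteq> snd e" if "e \<in> parcs (cycle_graph n)" for e
    using that assms by (auto simp: cycle_graph_def mod_Suc split: if_splits)
qed (auto simp: cycle_graph_def)

end

theory Submission
  imports Defs
begin

text \<open>Send a list of edges to the set of colors it uses an odd number of times; concatenation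
  becomes symmetric difference.  In a parity edge-coloring of an odd cycle, let \<open>X\<^sub>i\<close> be the set
  of the path from vertex \<open>0\<close> to vertex \<open>i\<close> and \<open>S\<close> that of the whole cycle, which is nonempty
  as the cycle has odd length.  Both paths joining two vertices fail to be parity paths, so the
  \<open>X\<^sub>i\<close> are distinct modulo \<open>S\<close>.  With \<open>k\<close> colors this leaves room for at most \<open>2 ^ (k - 1)\<close>
  vertices.  Conversely, a Gray code colors the path \<open>0, \<dots>, n - 1\<close>, and one additional
  color on the last edge of the cycle yields a strong parity edge-coloring.\<close>

section \<open>Color counts modulo 2, encoded as sets\<close>

definition odd_elems :: "'a list \<Rightarrow> 'a set" where
  "odd_elems xs = {a. odd (count_list xs a)}"

lemma odd_elems_Nil [simp]: "odd_elems [] = {}"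
  by (simp add: odd_elems_def)

lemma odd_elems_append: "odd_elems (xs @ ys) = sym_diff (odd_elems xs) (odd_elems ys)"
  by (auto simp: odd_elems_def)

lemma odd_elems_subset: "odd_elems xs \<subseteq> set xs"
  by (auto simp: odd_elems_def intro: ccontr dest: count_notin)

text \<open>The counts add up to the length, so they cannot all be even. In the lower bound this is
  where the oddness of the cycle enters.\<close>

lemma odd_elems_nonempty:
  assumes "odd (length xs)"
  shows "odd_elems xs \<noteq> {}"
proof
  assume "odd_elems xs = {}"
  then have "even (sum (count_list xs) (set xs))"
    by (intro dvd_sum) (auto simp: odd_elems_def)
  then show False
    using assms by (simp add: sum_count_set)
qed

lemma parity_walk_odd_elems:
  "parity_walk G c w \<longleftrightarrow> vwalk w (with_proj G) \<and> odd_elems (walk_colors c w) = {}"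
  by (auto simp: parity_walk_def odd_elems_def)

text \<open>A path with at least one edge has distinct ends, so a parity path would be an open
  parity walk.\<close>

lemma strong_parity_imp_parity:
  assumes "strong_parity_edge_coloring G c"
  shows "parity_edge_coloring G c"
  unfolding parity_edge_coloring_def
proof
  assume "\<exists>w. parity_path G c w"
  then obtain w where "parity_walk G c w" "distinct w" "length w \<ge> 2"
    by (auto simp: parity_path_def vpath_def)
  moreover from this have "hd w = last w"
    using assms by (auto simp: strong_parity_edge_coloring_def closed_vwalk_def)
  ultimately show False
    by (cases w) (auto split: if_splits)
qed

section \<open>Upper bound: coloring by a Gray code\<close>

text \<open>This is the reflected binary code, with words written as sets of bit positions: run
  through the code for \<open>k\<close> bits, then through it backwards with bit \<open>k\<close>
  set.\<close>

lemma gray_code: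
  "\<exists>f :: nat \<Rightarrow> nat set. inj_on f {..<2 ^ k} \<and> (\<forall>i<2 ^ k. f i \<subseteq> {..<k}) \<and>
     (\<forall>i. Suc i < 2 ^ k \<longrightarrow> (\<exists>a<k. sym_diff (f i) (f (Suc i)) = {a}))"
proof (induction k)
  case 0
  show ?case by (rule exI[of _ "\<lambda>_. {}"]) (auto simp: inj_on_def)
next
  case (Suc k)
  then obtain f where inj: "inj_on f {..<2 ^ k}" and sub: "\<And>i. i < 2 ^ k \<Longrightarrow> f i \<subseteq> {..<k}"
    and step: "\<And>i. Suc i < 2 ^ k \<Longrightarrow> \<exists>a<k. sym_diff (f i) (f (Suc i)) = {a}"
    by blast
  \<comment> \<open>\<open>r\<close> mirrors the index range, sending the second half onto the first
    in reverse order.\<close>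
  define r where "r i = 2 ^ Suc k - Suc i" for i :: nat
  define g where "g i = (if i < 2 ^ k then f i else insert k (f (r i)))" for i
  have r: "r i < 2 ^ k" if "i \<ge> 2 ^ k" "i < 2 ^ Suc k" for i
    using that by (auto simp: r_def)
  have k_notin: "k \<notin> f i" if "i < 2 ^ k" for i
    using sub[OF that] by auto
  have "inj_on g {..<2 ^ Suc k}"
  proof (rule inj_onI)
    fix i j assume ij: "i \<in> {..<2 ^ Suc k}" "j \<in> {..<2 ^ Suc k}" "g i = g j"
    have k_in: "k \<in> g l \<longleftrightarrow> \<not> l < 2 ^ k" for l
      using k_notin by (auto simp: g_def)
    show "i = j"
    proof (cases "i < 2 ^ k")
      case True
      then have "j < 2 ^ k" using k_in ij by metis
      then show ?thesis using True ij inj by (auto simp: g_def inj_on_def)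
    next
      case False
      then have j: "\<not> j < 2 ^ k" using k_in ij by metis
      then have "insert k (f (r i)) = insert k (f (r j))"
        using False ij by (simp add: g_def)
      moreover have "r i < 2 ^ k" "r j < 2 ^ k" using r False j ij by auto
      ultimately have "r i = r j"
        using inj k_notin by (metis inj_onD insert_ident lessThan_iff)
      then show ?thesis using ij by (auto simp: r_def)
    qed
  qed
  moreover have "g i \<subseteq> {..<Suc k}" if "i < 2 ^ Suc k" for i
  proof (cases "i < 2 ^ k")
    case True
    then show ?thesis using sub[of i] by (auto simp: g_def)
  next
    case False
    then show ?thesis using sub[of "r i"] r[of i] that by (auto simp: g_def)
  qed
  moreover have "\<exists>a<Suc k. sym_diff (g i) (g (Suc i)) = {a}" if i: "Suc i < 2 ^ Suc k" for i
  proof -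
    consider "Suc i < 2 ^ k" | "Suc i = 2 ^ k" | "i \<ge> 2 ^ k" by linarith
    then show ?thesis
    proof cases
      case 1
      then show ?thesis using step[of i] by (auto simp: g_def intro: less_SucI)
    next
      case 2
      \<comment> \<open>At the fold the mirrored index is \<open>i\<close> itself, so only bit
        \<open>k\<close> changes.\<close>
      then have "r (Suc i) = i" "i < 2 ^ k" by (auto simp: r_def)
      then have "sym_diff (g i) (g (Suc i)) = {k}"
        using 2 k_notin[of i] by (auto simp: g_def)
      then show ?thesis by blast
    next
      case 3
      have *: "Suc (r (Suc i)) = r i" using i by (auto simp: r_def)
      then have "Suc (r (Suc i)) < 2 ^ k" using r[of i] 3 i by auto
      from step[OF this] obtain a where
        a: "a < k" "sym_diff (f (r (Suc i))) (f (r i)) = {a}"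
        unfolding * by blast
      have "sym_diff (g i) (g (Suc i)) = {a}"
        using 3 a k_notin[of "r i"] k_notin[of "r (Suc i)"] r[of i] r[of "Suc i"] i
        by (auto simp: g_def)
      then show ?thesis using a by auto
    qed
  qed
  ultimately show ?case by (intro exI[of _ g]) simp
qed

text \<open>Along a walk, the steps across which \<open>p\<close> changes are counted modulo 2.\<close>

lemma odd_count_walk_colors:
  fixes p :: "'a \<Rightarrow> bool"
  assumes "vwalk w (with_proj G)"
    and "\<And>u v. (u, v) \<in> parcs G \<Longrightarrow>
      (p u \<noteq> p v) \<longleftrightarrow> (c {u, v} = a) \<noteq> (d \<and> c {u, v} = b)"
  shows "odd (count_list (walk_colors c w) a) \<longleftrightarrow>
    (p (hd w) \<noteq> p (last w)) \<noteq> (d \<and> odd (count_list (walk_colors c w) b))"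
  using assms(1)
proof (induction rule: vwalk_induct)
  case (Base u)
  show ?case by (simp add: walk_colors_def)
next
  case (Cons u v es)
  have "(p u \<noteq> p v) \<longleftrightarrow> (c {u, v} = a) \<noteq> (d \<and> c {u, v} = b)"
    using Cons by (intro assms(2)) simp
  with Cons.IH show ?case
    by (auto simp: walk_colors_def)
qed

text \<open>Separates the edges colored by the Gray code from the closing edge; unordered pairs
  cover both directions of traversal.\<close>

lemma parcs_cycle_graph_cases:
  assumes "(u, v) \<in> parcs (cycle_graph n)"
  obtains i where "Suc i < n" "{u, v} = {i, Suc i}" | "{u, v} = {0, n - 1}"
proof -
  have *: "(\<exists>l. Suc l < n \<and> {j, i} = {l, Suc l}) \<or> {j, i} = {0, n - 1}"
    if "j < n" "i = Suc j mod n" for i j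
  proof (cases "Suc j = n")
    case True
    then show ?thesis using that by auto
  next
    case False
    then show ?thesis using that by (intro disjI1 exI[of _ j]) auto
  qed
  have "(\<exists>l. Suc l < n \<and> {u, v} = {l, Suc l}) \<or> {u, v} = {0, n - 1}"
  proof (cases "v = Suc u mod n")
    case True
    then show ?thesis using assms by (intro *) (auto simp: cycle_graph_def)
  next
    case False
    then show ?thesis using assms
      by (subst (1 2) insert_commute, intro *) (auto simp: cycle_graph_def)
  qed
  then show thesis using that by blast
qed

text \<open>Indexing by all naturals turns the edge colors into a periodic sequence, so the lower
  bound needs no special case for arcs through vertex \<open>0\<close>.\<close>

lemma edges_cycle_graph:
  assumes "n > 0"
  shows "edges (cycle_graph n) = (\<lambda>i. {i mod n, Suc i mod n}) ` UNIV"
proof -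
  have "{i mod n, Suc i mod n} \<in> edges (cycle_graph n)" for i
    using assms unfolding edges_def cycle_graph_def
    by (intro CollectI exI[of _ "i mod n"] exI[of _ "Suc i mod n"]) (simp add: mod_Suc_eq)
  moreover have "e \<in> range (\<lambda>i. {i mod n, Suc i mod n})" if "e \<in> edges (cycle_graph n)" for e
  proof -
    from that obtain u where "u < n" "e = {u, Suc u mod n}"
      unfolding edges_def cycle_graph_def by (auto simp: insert_commute)
    then have "e = {u mod n, Suc u mod n}" by simp
    then show ?thesis by blast
  qed
  ultimately show ?thesis by blast
qed

lemma finite_edges_cycle_graph: "finite (edges (cycle_graph n))"
  by (rule finite_subset[of _ "Pow {..<n}"]) (auto simp: edges_def cycle_graph_def)

text \<open>A parity walk uses the closing edge evenly often, so it has no net effect on the code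
  word. Every bit then agrees at the two ends, and the code is injective.\<close>

lemma exists_strong_parity_coloring_cycle_graph:
  assumes "n \<ge> 3" and "n \<le> 2 ^ k"
  shows "\<exists>c. strong_parity_edge_coloring (cycle_graph n) c \<and>
    num_colors (cycle_graph n) c \<le> Suc k"
proof -
  obtain f :: "nat \<Rightarrow> nat set" where inj: "inj_on f {..<2 ^ k}"
    and sub: "\<And>i. i < 2 ^ k \<Longrightarrow> f i \<subseteq> {..<k}"
    and step: "\<And>i. Suc i < 2 ^ k \<Longrightarrow> \<exists>a<k. sym_diff (f i) (f (Suc i)) = {a}"
    using gray_code[of k] by blast
  obtain t where t: "\<And>i. Suc i < 2 ^ k \<Longrightarrow> t i < k \<and> sym_diff (f i) (f (Suc i)) = {t i}"
    using step by metis
  \<comment> \<open>\<open>Min\<close> recovers \<open>i\<close> from \<open>{i, Suc i}\<close>;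
    since \<open>n \<ge> 3\<close>, no such pair is the closing edge.\<close>
  define c where "c e = (if e = {0, n - 1} then k else t (Min e))" for e
  have c_path: "c {i, Suc i} = t i" for i
    using assms(1) by (auto simp: c_def doubleton_eq_iff min_def)
  have c_last: "c {0, n - 1} = k" by (simp add: c_def)
  have "closed_vwalk w" if w: "parity_walk (cycle_graph n) c w" for w
  proof -
    have walk: "vwalk w (with_proj (cycle_graph n))"
      and even: "\<And>a. even (count_list (walk_colors c w) a)"
      using w by (auto simp: parity_walk_def)
    have "a \<in> f (hd w) \<longleftrightarrow> a \<in> f (last w)" if "a < k" for a
    proof -
      \<comment> \<open>\<open>?d\<close> records whether crossing the closing edge, the only one of
        color \<open>k\<close>, flips bit \<open>a\<close>.\<close>
      let ?d = "(a \<in> f 0) \<noteq> (a \<in> f (n - 1))"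
      have "((a \<in> f u) \<noteq> (a \<in> f v)) \<longleftrightarrow> (c {u, v} = a) \<noteq> (?d \<and> c {u, v} = k)"
        if "(u, v) \<in> parcs (cycle_graph n)" for u v
        using that
      proof (cases rule: parcs_cycle_graph_cases)
        case (1 i)
        then have "t i < k \<and> sym_diff (f i) (f (Suc i)) = {t i}"
          using t assms(2) by auto
        then have "t i < k" and "a \<in> sym_diff (f i) (f (Suc i)) \<longleftrightarrow> t i = a"
          by auto
        moreover have "c {u, v} = t i" using 1 c_path by simp
        moreover have "(a \<in> f u) \<noteq> (a \<in> f v) \<longleftrightarrow> a \<in> sym_diff (f i) (f (Suc i))"
          using 1(2) by (auto simp: doubleton_eq_iff)
        ultimately show ?thesis by auto
      next
        case 2
        then have "c {u, v} = k" "((a \<in> f u) \<noteq> (a \<in> f v)) \<longleftrightarrow> ?d"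
          using c_last by (simp, auto simp: doubleton_eq_iff)
        then show ?thesis
          using \<open>a < k\<close> by auto
      qed
      from odd_count_walk_colors[where p = "\<lambda>v. a \<in> f v", OF walk this] even
      show ?thesis by simp
    qed
    moreover have "hd w < n" "last w < n"
      using walk by (auto simp: vwalk_def cycle_graph_def subset_iff)
    moreover have "f (hd w) \<subseteq> {..<k}" "f (last w) \<subseteq> {..<k}"
      using calculation(2,3) sub assms(2) by (meson order_less_le_trans)+
    ultimately have "f (hd w) = f (last w)" by blast
    then show ?thesis
      using inj \<open>hd w < n\<close> \<open>last w < n\<close> assms(2)
      by (auto simp: closed_vwalk_def inj_on_def)
  qed
  moreover have "c ` edges (cycle_graph n) \<subseteq> {..k}"
  proof
    fix x assume "x \<in> c ` edges (cycle_graph n)"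
    then obtain u v where x: "x = c {u, v}" "(u, v) \<in> parcs (cycle_graph n)"
      by (auto simp: edges_def)
    from x(2) show "x \<in> {..k}"
    proof (cases rule: parcs_cycle_graph_cases)
      case (1 i)
      then have "t i < k" using t assms(2) by auto
      then show ?thesis using 1 x c_path[of i] by simp
    next
      case 2
      then show ?thesis using x c_last by simp
    qed
  qed
  then have "num_colors (cycle_graph n) c \<le> Suc k"
    unfolding num_colors_def by (metis card_atMost card_mono finite_atMost)
  ultimately show ?thesis
    by (auto simp: strong_parity_edge_coloring_def)
qed

section \<open>Lower bound: counting color sets modulo that of the whole cycle\<close>

lemma vwalk_arcs_map_upt:
  "vwalk_arcs (map g [i..<Suc (i + l)]) = map (\<lambda>j. (g j, g (Suc j))) [i..<i + l]"
proof (induction l)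
  case 0
  show ?case by simp
next
  case (Suc l)
  have "vwalk_arcs (map g [i..<Suc (i + Suc l)]) =
    vwalk_arcs (map g [i..<Suc (i + l)] @ [g (Suc (i + l))])" by simp
  also have "\<dots> = vwalk_arcs (map g [i..<Suc (i + l)]) @ [(g (i + l), g (Suc (i + l)))]"
    by (subst vwalk_arcs_append) auto
  finally show ?case by (simp add: Suc.IH del: upt_Suc) (simp add: upt_Suc)
qed

lemma parity_coloring_cycle_graph_lower_bound:
  assumes "odd n" and "parity_edge_coloring (cycle_graph n) c"
  shows "n \<le> 2 ^ (num_colors (cycle_graph n) c - 1)"
proof -
  have n: "n > 0" using assms(1) by (cases n) auto
  define e where "e i = c {i mod n, Suc i mod n}" for i
  define C where "C = c ` edges (cycle_graph n)"
  have "range e = C"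
    unfolding C_def e_def edges_cycle_graph[OF n] image_image ..
  moreover have "finite C"
    unfolding C_def by (intro finite_imageI finite_edges_cycle_graph)
  ultimately have C: "range e = C" "finite C" by blast+
  \<comment> \<open>Fewer than \<open>n\<close> consecutive edges form a path, even across vertex
    \<open>0\<close>: its \<open>l + 1 \<le> n\<close> consecutive indices are distinct modulo
    \<open>n\<close>.\<close>
  have arc: "odd_elems (map e [i..<i + l]) \<noteq> {}" if l: "l > 0" "l < n" for i l
  proof
    assume empty: "odd_elems (map e [i..<i + l]) = {}"
    define w where "w = map (\<lambda>j. j mod n) [i..<Suc (i + l)]"
    have arcs: "vwalk_arcs w = map (\<lambda>j. (j mod n, Suc j mod n)) [i..<i + l]"
      unfolding w_def by (rule vwalk_arcs_map_upt)
    have "walk_colors c w = map e [i..<i + l]"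
      by (simp add: walk_colors_def arcs e_def)
    moreover have "vwalk w (with_proj (cycle_graph n))"
    proof
      show "set (vwalk_arcs w) \<subseteq> arcs_ends (with_proj (cycle_graph n))"
        using n by (auto simp: arcs cycle_graph_def mod_Suc_eq)
    qed (use n in \<open>auto simp: w_def cycle_graph_def\<close>)
    moreover have "inj_on (\<lambda>j. j mod n) {i..<Suc (i + l)}"
    proof (rule linorder_inj_onI)
      fix x y assume xy: "x < y" "x \<in> {i..<Suc (i + l)}" "y \<in> {i..<Suc (i + l)}"
      show "x mod n \<noteq> y mod n"
      proof
        assume "x mod n = y mod n"
        then have "n dvd y - x" using xy by (metis mod_eq_dvd_iff_nat less_imp_le)
        then show False using xy l by (auto dest: dvd_imp_le)
      qed
    qed auto
    then have "distinct w"
      unfolding w_def distinct_map set_upt by (auto simp del: upt_Suc)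
    moreover have "vwalk_length w \<ge> 1" using l by (simp add: w_def)
    ultimately have "parity_path (cycle_graph n) c w"
      using empty by (auto simp: parity_path_def parity_walk_odd_elems)
    then show False using assms(2) by (auto simp: parity_edge_coloring_def)
  qed
  define X where "X i = odd_elems (map e [0..<i])" for i
  have X_diff: "sym_diff (X i) (X j) = odd_elems (map e [i..<j])" if "i \<le> j" for i j
  proof -
    have "X j = sym_diff (X i) (odd_elems (map e [i..<j]))"
      using upt_add_eq_append[of 0 i "j - i"] that
      unfolding X_def odd_elems_append[symmetric] by simp
    then show ?thesis by blast
  qed
  \<comment> \<open>Indices may exceed \<open>n\<close>, so this also covers arcs that wrap
    around.\<close>
  have X_neq: "X i \<noteq> X j" if "i < j" "j < i + n" for i j
  proof -
    have "j - i > 0" "j - i < n" "i + (j - i) = j" using that by auto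
    then show ?thesis using arc[of "j - i" i] X_diff[of i j] that(1) by auto
  qed
  have "e (n + i) = e i" for i
    by (simp add: e_def mod_Suc)
  then have "map e [n..<n + i] = map e [0..<i]" for i
    by (intro nth_equalityI) auto
  then have X_shift: "X (n + i) = sym_diff (X n) (X i)" for i
    using upt_add_eq_append[of 0 n i] unfolding X_def odd_elems_append[symmetric]
    by simp
  \<comment> \<open>\<open>X n\<close> is the set of the whole cycle; toggling by it always changes
    the membership of \<open>b\<close>.\<close>
  obtain b where b: "b \<in> X n"
    using odd_elems_nonempty[of "map e [0..<n]"] assms(1) by (auto simp: X_def)
  have X_sub: "X i \<subseteq> C" for i
    using odd_elems_subset[of "map e [0..<i]"] C by (auto simp: X_def)
  \<comment> \<open>\<open>X i\<close> and \<open>X (n + i)\<close> are the two members of a class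
    modulo \<open>X n\<close>; \<open>Y i\<close> is the one avoiding \<open>b\<close>.\<close>
  define Y where "Y i = (if b \<in> X i then X (n + i) else X i)" for i
  have "inj_on Y {..<n}"
  proof (rule linorder_inj_onI)
    fix i j assume ij: "i < j" "i \<in> {..<n}" "j \<in> {..<n}"
    \<comment> \<open>The two inequalities come from the two complementary arcs between vertices
      \<open>i\<close> and \<open>j\<close>. Together they put \<open>X i\<close> and
      \<open>X j\<close> in different classes.\<close>
    have "X i \<noteq> X j" "X j \<noteq> X (n + i)" using X_neq ij by auto
    then show "Y i \<noteq> Y j"
      unfolding Y_def X_shift by auto
  qed auto
  moreover have "Y ` {..<n} \<subseteq> Pow (C - {b})"
  proof -
    have "Y i \<subseteq> C" "b \<notin> Y i" for i
      using b X_shift[of i] X_sub by (auto simp: Y_def)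
    then show ?thesis by blast
  qed
  ultimately have "n \<le> card (Pow (C - {b}))"
    using C(2) by (metis card_inj_on_le card_lessThan finite_Diff finite_Pow_iff)
  also have "\<dots> = 2 ^ (card C - 1)"
    using b X_sub C(2) by (metis card_Diff_singleton card_Pow finite_Diff subsetD)
  finally show ?thesis by (simp add: num_colors_def C_def)
qed

section \<open>The exact value from the matching bounds\<close>

theorem theorem2p7:
  fixes n :: nat
  assumes "n \<ge> 3" and "odd n"
  shows "parity_number (cycle_graph n) = strong_parity_number (cycle_graph n) \<and>
         int (strong_parity_number (cycle_graph n)) = \<lceil>log 2 (real n)\<rceil> + 1"
proof -
  let ?G = "cycle_graph n"
  define m where "m = nat \<lceil>log 2 (real n)\<rceil>"
  have "log 2 (real n) \<ge> 0" using assms(1) by simp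
  then have int_m: "int m = \<lceil>log 2 (real n)\<rceil>" by (simp add: m_def)
  \<comment> \<open>Thus \<open>m\<close> is the least exponent with \<open>n \<le> 2 ^ m\<close>,
    the form in which both bounds use it.\<close>
  have m_le: "n \<le> 2 ^ k \<longleftrightarrow> m \<le> k" for k
  proof -
    have "n \<le> 2 ^ k \<longleftrightarrow> real n \<le> 2 powr real k"
      by (metis of_nat_le_iff of_nat_numeral of_nat_power powr_realpow zero_less_numeral)
    also have "\<dots> \<longleftrightarrow> log 2 (real n) \<le> real k"
      using assms(1) by (simp add: log_le_iff)
    also have "\<dots> \<longleftrightarrow> m \<le> k"
      by (simp add: m_def ceiling_le_iff nat_le_iff)
    finally show ?thesis .
  qed
  have lower: "Suc m \<le> num_colors ?G c" if "parity_edge_coloring ?G c" for c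
  proof -
    have "m \<le> num_colors ?G c - 1"
      using parity_coloring_cycle_graph_lower_bound[OF assms(2) that] m_le by blast
    \<comment> \<open>This rules out zero colors, where the subtraction above would
      truncate.\<close>
    moreover have "m \<noteq> 0" using m_le[of 0] assms(1) by auto
    ultimately show ?thesis by linarith
  qed
  \<comment> \<open>This single coloring attains both minima, as \<open>lower\<close> applies to
    strong colorings too.\<close>
  obtain c where c: "strong_parity_edge_coloring ?G c" "num_colors ?G c \<le> Suc m"
    using exists_strong_parity_coloring_cycle_graph[OF assms(1)] m_le by blast
  then have c_num: "num_colors ?G c = Suc m"
    using lower[OF strong_parity_imp_parity] by (simp add: le_antisym)
  have "parity_number ?G = Suc m"
    unfolding parity_number_def
    by (rule Least_equality) (use c c_num lower strong_parity_imp_parity in blast)+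
  moreover have "strong_parity_number ?G = Suc m"
    unfolding strong_parity_number_def
    by (rule Least_equality) (use c c_num lower strong_parity_imp_parity in blast)+
  ultimately show ?thesis
    using int_m by simp
qed

end
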